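(* Let $F$ be a field of characteristic different from two with $|\dot F/\dot F^2|<\infty$. Then $F$ is formally real if and only if the class $x_{-1}\in H^1(\mathcal{G}_F,\mathbb{F}_2)$ is not nilpotent.
   Context: $\dot F=F^\times$; $\mathcal{G}_F=G_F/G_F^4[G_F^2,G_F]$ is the W-group, $G_F$ being the Galois group of the quadratic closure $F_q$ of $F$. For $a\in\dot F$, $x_a\in H^1(\mathcal{G}_F,\mathbb{F}_2)=\mathrm{Hom}(\mathcal{G}_F,\mathbb{Z}/2)$ is the homomorphism $x_a(\sigma)=\sigma(\sqrt a)/\sqrt a\in\{\pm1\}\cong\mathbb{Z}/2$. Formally real means $-1$ is not a sum of squares. *)

theory Defs
  imports "HOL-Library.Z2" "HOL-Algebra.Coset" "HOL-Algebra.Generated_Groups"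
begin

definition formally_real :: "'a::field itself \<Rightarrow> bool" where
  "formally_real _ \<longleftrightarrow> \<not> (\<exists>xs::'a list. sum_list (map (\<lambda>x. x * x) xs) = -1)"

definition square_classes :: "'a::field itself \<Rightarrow> 'a set set" where
  "square_classes _ = (\<lambda>a. {a * b * b | b. b \<noteq> 0}) ` {a::'a. a \<noteq> 0}"

definition is_quadratic_closure :: "('a::field \<Rightarrow> 'b::field) \<Rightarrow> bool" where
  "is_quadratic_closure i \<longleftrightarrow>
     (\<forall>a b. i (a + b) = i a + i b) \<and> (\<forall>a b. i (a * b) = i a * i b) \<and> i 1 = 1 \<and>
     (\<forall>x::'b. \<exists>y. y * y = x) \<and>
     (\<forall>S::'b set. (\<forall>a. i a \<in> S) \<and>
        (\<forall>x\<in>S. \<forall>y\<in>S. x + y \<in> S \<and> x * y \<in> S) \<and> (\<forall>x\<in>S. - x \<in> S) \<and>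
        (\<forall>x\<in>S. x \<noteq> 0 \<longrightarrow> inverse x \<in> S) \<and>
        (\<forall>x\<in>S. \<forall>y. y * y = x \<longrightarrow> y \<in> S) \<longrightarrow> S = UNIV)"

definition gal_aut :: "('a::field \<Rightarrow> 'b::field) \<Rightarrow> ('b \<Rightarrow> 'b) set" where
  "gal_aut i = {\<sigma>. bij \<sigma> \<and> (\<forall>x y. \<sigma> (x + y) = \<sigma> x + \<sigma> y) \<and>
                    (\<forall>x y. \<sigma> (x * y) = \<sigma> x * \<sigma> y) \<and> (\<forall>a. \<sigma> (i a) = i a)}"

definition galois_group :: "('a::field \<Rightarrow> 'b::field) \<Rightarrow> ('b \<Rightarrow> 'b) monoid" where
  "galois_group i = \<lparr>carrier = gal_aut i, mult = (\<circ>), one = id\<rparr>"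

definition W_kernel :: "('a::field \<Rightarrow> 'b::field) \<Rightarrow> ('b \<Rightarrow> 'b) set" where
  "W_kernel i = (let G = galois_group i in
     generate G ({\<sigma> [^]\<^bsub>G\<^esub> (4::nat) | \<sigma>. \<sigma> \<in> carrier G} \<union>
                 {(\<sigma> [^]\<^bsub>G\<^esub> (2::nat)) \<otimes>\<^bsub>G\<^esub> \<tau> \<otimes>\<^bsub>G\<^esub> inv\<^bsub>G\<^esub> (\<sigma> [^]\<^bsub>G\<^esub> (2::nat))
                     \<otimes>\<^bsub>G\<^esub> inv\<^bsub>G\<^esub> \<tau> | \<sigma> \<tau>. \<sigma> \<in> carrier G \<and> \<tau> \<in> carrier G}))"

definition W_group :: "('a::field \<Rightarrow> 'b::field) \<Rightarrow> ('b \<Rightarrow> 'b) set monoid" where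
  "W_group i = galois_group i Mod W_kernel i"

text \<open>x_a(sigma) = sigma(sqrt a)/sqrt a in {+-1} = Z/2, evaluated on a coset via a representative.\<close>
definition x_class :: "('a::field \<Rightarrow> 'b::field) \<Rightarrow> 'a \<Rightarrow> ('b \<Rightarrow> 'b) set \<Rightarrow> bit" where
  "x_class i a C = (let r = (SOME r. r * r = i a); \<sigma> = (SOME \<sigma>. \<sigma> \<in> C)
                    in if \<sigma> r = r then 0 else 1)"

section \<open>Cohomology H^*(G, F_2) with trivial coefficients via inhomogeneous cochains\<close>

text \<open>An n-cochain is a function on length-n lists of group elements.
  Coboundary (signs irrelevant mod 2, trivial action).\<close>
definition coboundary :: "('g, 'm) monoid_scheme \<Rightarrow> ('g list \<Rightarrow> bit) \<Rightarrow> 'g list \<Rightarrow> bit" where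
  "coboundary G f gs = f (tl gs) +
     (\<Sum>k<length gs - 1. f (take k gs @ [gs ! k \<otimes>\<^bsub>G\<^esub> gs ! (k + 1)] @ drop (k + 2) gs)) +
     f (butlast gs)"

definition is_coboundary :: "('g, 'm) monoid_scheme \<Rightarrow> nat \<Rightarrow> ('g list \<Rightarrow> bit) \<Rightarrow> bool" where
  "is_coboundary G n c \<longleftrightarrow> (\<exists>h. \<forall>gs. set gs \<subseteq> carrier G \<and> length gs = n \<longrightarrow> c gs = coboundary G h gs)"

definition cup_power :: "('g \<Rightarrow> bit) \<Rightarrow> 'g list \<Rightarrow> bit" where
  "cup_power x gs = prod_list (map x gs)"

definition nilpotent_class :: "('g, 'm) monoid_scheme \<Rightarrow> ('g \<Rightarrow> bit) \<Rightarrow> bool" where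
  "nilpotent_class G x \<longleftrightarrow> (\<exists>n\<ge>1. is_coboundary G n (cup_power x))"

end

theory Submission
  imports Defs
begin

text \<open>
  If \<open>-1\<close> is a sum of squares, then \<open>1 = \<Sum>k. - x\<^sub>k\<^sup>2\<close>, and Milnor's argument for K-theory modulo 2
  shows that a product of classes of nonzero elements with sum 1 vanishes. It only needs the
  bilinearity and commutativity of products of degree one classes and the Steinberg relation
  \<open>x\<^sub>a x\<^sub>b = 0\<close> for \<open>a + b = 1\<close>. The latter holds already over the W-group, because the dihedral
  extension of \<open>F(\<surd>a, \<surd>b)\<close> that witnesses it has a Galois group of exponent four with central squares.

  If \<open>F\<close> is formally real, the quadratic closure has a maximal formally real subfield \<open>R\<close>, and is equal
  to \<open>R(\<surd>-1)\<close>. Complex conjugation maps to an element of order two in the W-group on which the class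
  of \<open>-1\<close> does not vanish, and all powers of this class survive restriction to the group of order two.
\<close>

text \<open>Keeping sums and products in \<open>bit\<close>, rather than Boolean operations, lets
  ring normalisation work in characteristic two.\<close>

declare add_bit_eq_xor [simp del] mult_bit_eq_and [simp del]

lemma bit_add_self [simp]: "b + b = (0::bit)"
  by (cases b) (simp_all only: add_0 one_add_one bit_2_eq_0)

lemma bit_add_self_left [simp]: "b + (b + c) = (c::bit)"
  by (simp add: add.assoc [symmetric])

lemma bit_add_eq_0_iff: "b + c = 0 \<longleftrightarrow> b = (c::bit)"
  by (metis add_0_right bit_add_self bit_add_self_left)

section \<open>Cochains with values in the field of two elements\<close>

text \<open>The cup product with a degree one cochain on the left.\<close>

definition cup1 :: "('g \<Rightarrow> bit) \<Rightarrow> ('g list \<Rightarrow> bit) \<Rightarrow> 'g list \<Rightarrow> bit" where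
  "cup1 x c gs = x (hd gs) * c (tl gs)"

text \<open>The constant 1 is the unit in degree 0. Arguments beyond the length of the list of
  cochains are ignored.\<close>

primrec cup_list :: "('g \<Rightarrow> bit) list \<Rightarrow> 'g list \<Rightarrow> bit" where
  "cup_list [] = (\<lambda>_. 1)"
| "cup_list (x # xs) = cup1 x (cup_list xs)"

text \<open>For the trivial action these are the 1-cocycles.\<close>

definition additive :: "('g, 'm) monoid_scheme \<Rightarrow> ('g \<Rightarrow> bit) \<Rightarrow> bool" where
  "additive G x \<longleftrightarrow> (\<forall>g\<in>carrier G. \<forall>h\<in>carrier G. x (g \<otimes>\<^bsub>G\<^esub> h) = x g + x h)"

lemma coboundary_singleton [simp]: "coboundary G h [g] = 0"
  by (simp add: coboundary_def)

text \<open>Apart from the first two faces, every face keeps \<open>g1\<close> in front, so these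
  assemble into the coboundary with \<open>g1\<close> held fixed. That coboundary also contains the
  face \<open>h (g1 # gs)\<close>, which the third summand cancels modulo 2. Inductions on the
  degree run through this recursion.\<close>

lemma coboundary_Cons_Cons:
  "coboundary G h (g1 # g2 # gs) =
     h (g2 # gs) + h ((g1 \<otimes>\<^bsub>G\<^esub> g2) # gs) + h (g1 # gs) + coboundary G (\<lambda>l. h (g1 # l)) (g2 # gs)"
proof -
  have "(\<Sum>k<length (g1 # g2 # gs) - 1. h (take k (g1 # g2 # gs)
           @ [(g1 # g2 # gs) ! k \<otimes>\<^bsub>G\<^esub> (g1 # g2 # gs) ! (k + 1)] @ drop (k + 2) (g1 # g2 # gs)))
      = h ((g1 \<otimes>\<^bsub>G\<^esub> g2) # gs) + (\<Sum>k<length (g2 # gs) - 1. h (g1 # take k (g2 # gs)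
           @ [(g2 # gs) ! k \<otimes>\<^bsub>G\<^esub> (g2 # gs) ! (k + 1)] @ drop (k + 2) (g2 # gs)))"
    by (simp add: sum.lessThan_Suc_shift del: sum.lessThan_Suc)
  then show ?thesis
    by (simp add: coboundary_def ac_simps)
qed

lemma coboundary_mult_const: "coboundary G (\<lambda>l. h l * b) gs = coboundary G h gs * b"
  by (simp add: coboundary_def distrib_right sum_distrib_right)

lemma coboundary_add: "coboundary G (\<lambda>l. h l + k l) gs = coboundary G h gs + coboundary G k gs"
  by (simp add: coboundary_def sum.distrib ac_simps)

lemma is_coboundary_cong:
  assumes "is_coboundary G n c"
    and "\<And>gs. set gs \<subseteq> carrier G \<Longrightarrow> length gs = n \<Longrightarrow> d gs = c gs"
  shows "is_coboundary G n d"
  using assms unfolding is_coboundary_def by metis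

lemma is_coboundary_zero: "is_coboundary G n (\<lambda>_. 0)"
  unfolding is_coboundary_def by (rule exI [of _ "\<lambda>_. 0"]) (simp add: coboundary_def)

lemma is_coboundary_add:
  assumes "is_coboundary G n c" "is_coboundary G n d"
  shows "is_coboundary G n (\<lambda>gs. c gs + d gs)"
proof -
  obtain h k where "\<forall>gs. set gs \<subseteq> carrier G \<and> length gs = n \<longrightarrow> c gs = coboundary G h gs"
    and "\<forall>gs. set gs \<subseteq> carrier G \<and> length gs = n \<longrightarrow> d gs = coboundary G k gs"
    using assms unfolding is_coboundary_def by blast
  then show ?thesis
    unfolding is_coboundary_def by (intro exI [of _ "\<lambda>l. h l + k l"]) (simp add: coboundary_add)
qed

text \<open>The Leibniz rule, in which the term with the coboundary of \<open>x\<close> drops out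
  because \<open>x\<close> is a cocycle.\<close>

lemma coboundary_cup1:
  assumes "x (g1 \<otimes>\<^bsub>G\<^esub> g2) = x g1 + x g2"
  shows "coboundary G (cup1 x h) (g1 # g2 # gs) = x g1 * coboundary G h (g2 # gs)"
  using assms
  by (simp add: coboundary_Cons_Cons coboundary_mult_const cup1_def algebra_simps)

text \<open>By the Leibniz rule, if \<open>h\<close> bounds \<open>c\<close> then
  \<open>cup1 x h\<close> bounds \<open>cup1 x c\<close>. The bound on \<open>n\<close> provides the
  two leading arguments of that rule.\<close>

lemma is_coboundary_cup1:
  assumes "additive G x" "is_coboundary G n c" "n \<ge> 1"
  shows "is_coboundary G (Suc n) (cup1 x c)"
proof -
  obtain h where h: "\<And>gs. set gs \<subseteq> carrier G \<Longrightarrow> length gs = n \<Longrightarrow> c gs = coboundary G h gs"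
    using assms(2) unfolding is_coboundary_def by blast
  have "cup1 x c gs = coboundary G (cup1 x h) gs"
    if gs: "set gs \<subseteq> carrier G" "length gs = Suc n" for gs
  proof -
    obtain g1 g2 r where "gs = g1 # g2 # r"
      using gs(2) assms(3) by (metis Suc_le_length_iff Suc_le_mono One_nat_def order_refl)
    with gs show ?thesis
      using assms(1) h [of "g2 # r"]
      by (subst \<open>gs = _\<close>, subst coboundary_cup1) (auto simp: additive_def cup1_def)
  qed
  then show ?thesis unfolding is_coboundary_def by blast
qed

text \<open>Products of cocycles are cocycles, by iterating the Leibniz rule; the empty product
  gives 1 + 1 = 0.\<close>

lemma coboundary_cup_list:
  assumes "\<forall>x\<in>set xs. additive G x" "set gs \<subseteq> carrier G" "length gs = Suc (length xs)"
  shows "coboundary G (cup_list xs) gs = 0"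
  using assms
proof (induction xs arbitrary: gs)
  case Nil
  then obtain g where "gs = [g]" by (auto simp: length_Suc_conv)
  then show ?case by simp
next
  case (Cons x xs)
  then obtain g1 g2 r where gs: "gs = g1 # g2 # r"
    by (auto simp: length_Suc_conv)
  with Cons show ?case
    by (simp add: coboundary_cup1 additive_def)
qed

text \<open>The Leibniz rule on the other side: a cochain bounding \<open>c\<close>, cupped with the
  cocycle \<open>cup_list xs\<close>, bounds the product. Here \<open>c\<close> may be a sum of
  products, as the relations below require.\<close>

lemma is_coboundary_mult_cup_list:
  assumes "is_coboundary G 2 (\<lambda>gs. c (gs ! 0) (gs ! 1))" "\<forall>x\<in>set xs. additive G x"
  shows "is_coboundary G (2 + length xs) (\<lambda>gs. c (gs ! 0) (gs ! 1) * cup_list xs (drop 2 gs))"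
proof -
  obtain h where h: "\<And>gs. set gs \<subseteq> carrier G \<Longrightarrow> length gs = 2 \<Longrightarrow>
      c (gs ! 0) (gs ! 1) = coboundary G h gs"
    using assms(1) unfolding is_coboundary_def by blast
  let ?h = "cup1 (\<lambda>g. h [g]) (cup_list xs)"
  have "c (gs ! 0) (gs ! 1) * cup_list xs (drop 2 gs) = coboundary G ?h gs"
    if gs: "set gs \<subseteq> carrier G" "length gs = 2 + length xs" for gs
  proof -
    obtain g1 g2 r where gs': "gs = g1 # g2 # r"
      using gs(2) by (auto simp: length_Suc_conv)
    have "coboundary G (cup_list xs) (g2 # r) = 0"
      using gs gs' assms(2) by (intro coboundary_cup_list) auto
    moreover have "c g1 g2 = h [g2] + h [g1 \<otimes>\<^bsub>G\<^esub> g2] + h [g1]"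
      using h [of "[g1, g2]"] gs gs' by (simp add: coboundary_Cons_Cons)
    ultimately show ?thesis
      by (simp add: gs' coboundary_Cons_Cons coboundary_mult_const cup1_def algebra_simps)
  qed
  then show ?thesis unfolding is_coboundary_def by blast
qed

text \<open>The hypothesis has the shape of \<open>twisted\<close>, so a dihedral extension supplies
  such an \<open>h\<close>. In degree two a coboundary evaluates its cochain on singletons only,
  hence the witness through \<open>hd\<close>.\<close>

lemma is_coboundary_2I:
  assumes "\<And>g1 g2. g1 \<in> carrier G \<Longrightarrow> g2 \<in> carrier G \<Longrightarrow> h (g1 \<otimes>\<^bsub>G\<^esub> g2) = h g1 + h g2 + c g1 g2"
  shows "is_coboundary G 2 (\<lambda>gs. c (gs ! 0) (gs ! 1))"
  unfolding is_coboundary_def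
proof (intro exI [of _ "\<lambda>gs. h (hd gs)"] allI impI)
  fix gs assume gs: "set gs \<subseteq> carrier G \<and> length gs = 2"
  then obtain g1 g2 where "gs = [g1, g2]"
    by (auto simp: length_Suc_conv numeral_2_eq_2)
  with gs show "c (gs ! 0) (gs ! 1) = coboundary G (\<lambda>gs. h (hd gs)) gs"
    by (simp add: coboundary_Cons_Cons assms algebra_simps)
qed

text \<open>The pointwise product of \<open>x\<close> and \<open>y\<close> is a bounding cochain:
  its failure to be additive consists of the two cross terms.\<close>

lemma is_coboundary_cup_commute:
  assumes "additive G x" "additive G y"
  shows "is_coboundary G 2 (\<lambda>gs. x (gs ! 0) * y (gs ! 1) + y (gs ! 0) * x (gs ! 1))"
  by (rule is_coboundary_2I [where h = "\<lambda>g. x g * y g" and c = "\<lambda>g h. x g * y h + y g * x h"])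
     (use assms in \<open>simp add: additive_def algebra_simps\<close>)

section \<open>Detection on an element of order two\<close>

lemma sum_lists_Suc:
  assumes "finite A"
  shows "(\<Sum>gs | set gs \<subseteq> A \<and> length gs = Suc n. f gs) =
         (\<Sum>g\<in>A. \<Sum>gs | set gs \<subseteq> A \<and> length gs = n. f (g # gs))"
proof -
  have "(\<Sum>gs | set gs \<subseteq> A \<and> length gs = Suc n. f gs) =
        (\<Sum>p\<in>A \<times> {gs. set gs \<subseteq> A \<and> length gs = n}. f (fst p # snd p))"
    by (rule sum.reindex_bij_witness [of _ "\<lambda>p. fst p # snd p" "\<lambda>gs. (hd gs, tl gs)"])
       (auto simp: length_Suc_conv)
  then show ?thesis
    using assms by (simp add: sum.cartesian_product case_prod_beta)
qed

text \<open>The sum over all tuples from the subgroup of order two is a cycle in the bar complex: every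
  face is hit an even number of times.\<close>
lemma sum_coboundary_order_two:
  assumes "e \<otimes>\<^bsub>G\<^esub> e = e" "e \<otimes>\<^bsub>G\<^esub> s = s" "s \<otimes>\<^bsub>G\<^esub> e = s" "s \<otimes>\<^bsub>G\<^esub> s = e" "e \<noteq> s"
  shows "(\<Sum>gs | set gs \<subseteq> {e, s} \<and> length gs = Suc n. coboundary G h gs) = 0"
proof (induction n arbitrary: h)
  case 0
  show ?case by (simp add: sum_lists_Suc assms(5))
next
  case (Suc n)
  have *: "(\<Sum>gs | set gs \<subseteq> {e, s} \<and> length gs = n. coboundary G (\<lambda>l. h (g # l)) (e # gs)) +
        (\<Sum>gs | set gs \<subseteq> {e, s} \<and> length gs = n. coboundary G (\<lambda>l. h (g # l)) (s # gs)) = 0" for g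
    using Suc [of "\<lambda>l. h (g # l)"] assms(5) by (simp add: sum_lists_Suc)
  show ?case
    using * [of e] * [of s]
    by (simp add: sum_lists_Suc assms coboundary_Cons_Cons sum.distrib algebra_simps)
qed

text \<open>Only the tuple with all entries equal to \<open>s\<close> contributes.\<close>

lemma sum_cup_power_order_two:
  assumes "x e = 0" "x s = 1" "e \<noteq> s"
  shows "(\<Sum>gs | set gs \<subseteq> {e, s} \<and> length gs = n. cup_power x gs) = 1"
proof (induction n)
  case 0
  have "{gs. set gs \<subseteq> {e, s} \<and> length gs = 0} = {[]}" by auto
  then show ?case by (simp add: cup_power_def)
next
  case (Suc n)
  then show ?case by (simp add: sum_lists_Suc assms cup_power_def)
qed

text \<open>The cycle of all tuples from \<open>e\<close> and \<open>s\<close> pairs to 1 with each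
  cup power and to 0 with each coboundary of positive degree.\<close>

lemma not_nilpotent_class_if_order_two:
  assumes "e \<otimes>\<^bsub>G\<^esub> e = e" "e \<otimes>\<^bsub>G\<^esub> s = s" "s \<otimes>\<^bsub>G\<^esub> e = s" "s \<otimes>\<^bsub>G\<^esub> s = e"
    and "e \<in> carrier G" "s \<in> carrier G" "x e = 0" "x s = 1"
  shows "\<not> nilpotent_class G x"
proof
  assume "nilpotent_class G x"
  then obtain n h where "n \<ge> 1" and h: "\<And>gs. set gs \<subseteq> carrier G \<Longrightarrow> length gs = n \<Longrightarrow>
      cup_power x gs = coboundary G h gs"
    unfolding nilpotent_class_def is_coboundary_def by blast
  then obtain m where m: "n = Suc m" by (cases n) auto
  have "e \<noteq> s" using assms(7,8) by auto
  have "(1::bit) = (\<Sum>gs | set gs \<subseteq> {e, s} \<and> length gs = n. cup_power x gs)"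
    using assms \<open>e \<noteq> s\<close> by (simp add: sum_cup_power_order_two)
  also have "\<dots> = (\<Sum>gs | set gs \<subseteq> {e, s} \<and> length gs = n. coboundary G h gs)"
    using assms(5,6) by (intro sum.cong refl h) auto
  also have "\<dots> = 0"
    unfolding m by (rule sum_coboundary_order_two [OF assms(1-4) \<open>e \<noteq> s\<close>])
  finally show False by simp
qed

section \<open>Maximal formally real subfields\<close>

definition subfield_set :: "'b::field set \<Rightarrow> bool" where
  "subfield_set S \<longleftrightarrow> 1 \<in> S \<and> (\<forall>x\<in>S. \<forall>y\<in>S. x + y \<in> S \<and> x * y \<in> S) \<and>
     (\<forall>x\<in>S. - x \<in> S \<and> inverse x \<in> S)"

inductive_set sum_squares :: "'b::field set \<Rightarrow> 'b set" for S where
  zero: "0 \<in> sum_squares S"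
| step: "a \<in> sum_squares S \<Longrightarrow> x \<in> S \<Longrightarrow> a + x * x \<in> sum_squares S"

lemma subfield_setD:
  assumes "subfield_set S"
  shows "1 \<in> S" "0 \<in> S" "x \<in> S \<Longrightarrow> y \<in> S \<Longrightarrow> x + y \<in> S" "x \<in> S \<Longrightarrow> y \<in> S \<Longrightarrow> x * y \<in> S"
    "x \<in> S \<Longrightarrow> - x \<in> S" "x \<in> S \<Longrightarrow> inverse x \<in> S" "x \<in> S \<Longrightarrow> y \<in> S \<Longrightarrow> x - y \<in> S"
    "x \<in> S \<Longrightarrow> y \<in> S \<Longrightarrow> x / y \<in> S"
proof -
  show *: "1 \<in> S" "x \<in> S \<Longrightarrow> y \<in> S \<Longrightarrow> x + y \<in> S" "x \<in> S \<Longrightarrow> y \<in> S \<Longrightarrow> x * y \<in> S"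
    "x \<in> S \<Longrightarrow> - x \<in> S" "x \<in> S \<Longrightarrow> inverse x \<in> S"
    using assms by (auto simp: subfield_set_def)
  have "1 + (- 1) \<in> S"
    using assms unfolding subfield_set_def by blast
  then show "0 \<in> S" by simp
  show "x \<in> S \<Longrightarrow> y \<in> S \<Longrightarrow> x - y \<in> S"
    using assms unfolding subfield_set_def by (metis diff_conv_add_uminus)
  show "x \<in> S \<Longrightarrow> y \<in> S \<Longrightarrow> x / y \<in> S"
    using assms unfolding subfield_set_def by (metis divide_inverse)
qed

lemma sum_squares_square: "x \<in> S \<Longrightarrow> x * x \<in> sum_squares S"
  using sum_squares.step [OF sum_squares.zero] by fastforce

lemma sum_squares_add:
  assumes "a \<in> sum_squares S" "b \<in> sum_squares S"
  shows "a + b \<in> sum_squares S"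
  using assms(2)
proof induction
  case (step b x)
  then show ?case using sum_squares.step [of "a + b" S x] by (simp add: add.assoc)
qed (use assms in simp)

definition adjoin :: "'b::field set \<Rightarrow> 'b \<Rightarrow> 'b set" where
  "adjoin S s = {x + y * s | x y. x \<in> S \<and> y \<in> S}"

lemma adjoinI: "x \<in> S \<Longrightarrow> y \<in> S \<Longrightarrow> x + y * s \<in> adjoin S s"
  by (auto simp: adjoin_def)

context
  fixes S :: "'b::field set"
  assumes S: "subfield_set S"
begin

lemma sum_squares_subset: "a \<in> sum_squares S \<Longrightarrow> a \<in> S"
  by (induction rule: sum_squares.induct) (use S in \<open>auto simp: subfield_setD\<close>)

lemma sum_squares_mult_square:
  assumes "a \<in> sum_squares S" "y \<in> S"
  shows "a * (y * y) \<in> sum_squares S"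
  using assms(1)
proof induction
  case (step a x)
  have "(a + x * x) * (y * y) = a * (y * y) + (x * y) * (x * y)" by (simp add: algebra_simps)
  with step show ?case
    using S assms(2) by (simp only: sum_squares.step subfield_setD)
qed (simp add: sum_squares.zero)

lemma sum_squares_mult:
  assumes "a \<in> sum_squares S" "b \<in> sum_squares S"
  shows "a * b \<in> sum_squares S"
  using assms(2)
proof induction
  case (step b x)
  then show ?case
    using sum_squares_mult_square [OF assms(1)] by (simp add: distrib_left sum_squares_add)
qed (simp add: sum_squares.zero)

text \<open>A quotient \<open>a / b\<close> is the product \<open>a * b\<close> times the square of
  \<open>inverse b\<close>.\<close>

lemma sum_squares_divide:
  assumes "a \<in> sum_squares S" "b \<in> sum_squares S"
  shows "a / b \<in> sum_squares S"
proof -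
  have "a / b = a * b * (inverse b * inverse b)"
    by (cases "b = 0") (auto simp: field_simps)
  then show ?thesis
    using assms S by (metis sum_squares_mult sum_squares_mult_square sum_squares_subset subfield_setD(6))
qed

lemma adjoin_base: "x \<in> S \<Longrightarrow> x \<in> adjoin S s"
  using adjoinI [of x S 0 s] S by (simp add: subfield_setD)

lemma adjoin_root: "s \<in> adjoin S s"
  using adjoinI [of 0 S 1 s] S by (simp add: subfield_setD)

text \<open>If the coefficients of \<open>s\<close> differed, solving the equation for
  \<open>s\<close> would place it in \<open>S\<close>.\<close>

lemma adjoin_unique:
  assumes "s \<notin> S" "x \<in> S" "y \<in> S" "x' \<in> S" "y' \<in> S" "x + y * s = x' + y' * s"
  shows "x = x'" "y = y'"
proof -
  show "y = y'"
  proof (rule ccontr)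
    assume "y \<noteq> y'"
    then have "s = (x' - x) / (y - y')"
      using assms(6) by (simp add: field_simps)
    with S assms show False by (simp add: subfield_setD)
  qed
  with assms(6) show "x = x'" by simp
qed

lemma subfield_set_adjoin:
  assumes "s * s \<in> S"
  shows "subfield_set (adjoin S s)"
proof (cases "s \<in> S")
  case True
  have "adjoin S s = S"
    using True adjoin_base [of _ s] S by (auto simp: adjoin_def subfield_setD)
  then show ?thesis using S by simp
next
  case False
  show ?thesis
    unfolding subfield_set_def
  proof (intro conjI ballI)
    show "1 \<in> adjoin S s" using S by (simp add: adjoin_base subfield_setD)
  next
    fix p assume "p \<in> adjoin S s"
    then obtain x y where p: "p = x + y * s" "x \<in> S" "y \<in> S"
      by (auto simp: adjoin_def)
    have "- p = (- x) + (- y) * s" by (simp add: p)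
    then show "- p \<in> adjoin S s" using p S by (simp only: adjoinI subfield_setD)
    show "inverse p \<in> adjoin S s"
    proof (cases "p = 0")
      case True
      then show ?thesis using S by (simp add: adjoin_base subfield_setD)
    next
      case p0: False
      have "x - y * s \<noteq> 0"
      proof
        assume "x - y * s = 0"
        then have "x + (- y) * s = 0 + 0 * s" by simp
        then have "x = 0" "- y = 0"
          using adjoin_unique [OF False, of x "- y" 0 0] p S by (auto simp: subfield_setD)
        with p p0 show False by simp
      qed
      \<comment> \<open>The norm of \<open>p\<close>, which lies in \<open>S\<close> because
        \<open>s * s\<close> does; inverses come from dividing the conjugate by it.\<close>
      define d where "d = (x * x - y * y * (s * s))"
      have "d = p * (x - y * s)" by (simp add: d_def p algebra_simps)
      with p0 \<open>x - y * s \<noteq> 0\<close> have "inverse p = (x - y * s) / d"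
        by (simp add: inverse_eq_divide)
      also have "\<dots> = x / d + (- y / d) * s" by (simp add: diff_divide_distrib)
      finally have inv: "inverse p = x / d + (- y / d) * s" .
      have "d \<in> S" using p assms S by (simp add: d_def subfield_setD)
      then show ?thesis unfolding inv using p S by (intro adjoinI subfield_setD)
    qed
    fix q assume "q \<in> adjoin S s"
    then obtain x' y' where q: "q = x' + y' * s" "x' \<in> S" "y' \<in> S"
      by (auto simp: adjoin_def)
    have "p + q = (x + x') + (y + y') * s" by (simp add: p q algebra_simps)
    then show "p + q \<in> adjoin S s" using p q S by (simp only: adjoinI subfield_setD)
    have "p * q = (x * x' + y * y' * (s * s)) + (x * y' + y * x') * s" by (simp add: p q algebra_simps)
    then show "p * q \<in> adjoin S s" using p q S assms by (simp only: adjoinI subfield_setD)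
  qed
qed

text \<open>Expanding each square \<open>(x + y * s) * (x + y * s)\<close>, the squares of the
  \<open>x\<close> are collected in \<open>p\<close>, those of the \<open>y\<close> in
  \<open>q\<close>, and the mixed terms in \<open>t\<close>.\<close>

lemma sum_squares_adjoin:
  assumes "c \<in> sum_squares (adjoin S s)"
  obtains p q t where "p \<in> sum_squares S" "q \<in> sum_squares S" "t \<in> S" "c = (p + s * s * q) + t * s"
proof -
  have "\<exists>p q t. p \<in> sum_squares S \<and> q \<in> sum_squares S \<and> t \<in> S \<and> c = (p + s * s * q) + t * s"
    using assms
  proof induction
    case zero
    have "0 = (0 + s * s * 0) + 0 * s" by simp
    then show ?case using S by (metis sum_squares.zero subfield_setD(2))
  next
    case (step c z)
    then obtain p q t x y where c: "p \<in> sum_squares S" "q \<in> sum_squares S" "t \<in> S"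
        "c = (p + s * s * q) + t * s" and z: "x \<in> S" "y \<in> S" "z = x + y * s"
      by (auto simp: adjoin_def)
    have "c + z * z = (p + x * x) + s * s * (q + y * y) + (t + (x * y + x * y)) * s"
      by (simp add: c z algebra_simps)
    moreover have "p + x * x \<in> sum_squares S" "q + y * y \<in> sum_squares S"
      using c z by (auto intro: sum_squares.step)
    moreover have "t + (x * y + x * y) \<in> S" by (intro subfield_setD(3,4) [OF S] c z)
    ultimately show ?case by metis
  qed
  with that show ?thesis by blast
qed

end

section \<open>Formally real subfields under unions of chains, and Zorn's lemma\<close>

lemma sum_squares_Union_chain:
  assumes "subset.chain A C" "C \<noteq> {}" "a \<in> sum_squares (\<Union>C)"
  shows "\<exists>S\<in>C. a \<in> sum_squares S"
  using assms(3)
proof induction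
  case zero
  then show ?case using assms(2) by (auto intro: sum_squares.zero)
next
  case (step a x)
  then obtain S T where ST: "S \<in> C" "a \<in> sum_squares S" "T \<in> C" "x \<in> T" by auto
  have mono: "b \<in> sum_squares V" if "b \<in> sum_squares U" "U \<subseteq> V" for b and U V :: "'a set"
    using that by (induction rule: sum_squares.induct) (auto intro: sum_squares.intros)
  \<comment> \<open>The partial sum and the new summand live in two comparable members of the chain,
    so the larger one contains both.\<close>
  from ST have "S \<subseteq> T \<or> T \<subseteq> S"
    using assms(1) by (auto simp: subset_chain_def)
  with ST show ?case
    by (meson mono subsetD sum_squares.step)
qed

lemma subfield_set_Union_chain:
  assumes "subset.chain A C" "C \<noteq> {}" "\<And>S. S \<in> C \<Longrightarrow> subfield_set S"
  shows "subfield_set (\<Union>C)"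
  unfolding subfield_set_def
proof (intro conjI ballI)
  show "1 \<in> \<Union>C" using assms(2,3) subfield_setD(1) by blast
next
  fix x assume "x \<in> \<Union>C"
  then obtain S where S: "S \<in> C" "x \<in> S" by auto
  then show "- x \<in> \<Union>C" "inverse x \<in> \<Union>C"
    using subfield_setD(5,6) [OF assms(3) [OF S(1)] S(2)] by auto
  fix y assume "y \<in> \<Union>C"
  then obtain T where T: "T \<in> C" "y \<in> T" by auto
  from S T have "S \<subseteq> T \<or> T \<subseteq> S"
    using assms(1) by (auto simp: subset_chain_def)
  with S T obtain U where "U \<in> C" "x \<in> U" "y \<in> U" by blast
  then show "x + y \<in> \<Union>C" "x * y \<in> \<Union>C"
    using subfield_setD(3,4) [OF assms(3) [OF \<open>U \<in> C\<close>] \<open>x \<in> U\<close> \<open>y \<in> U\<close>] by auto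
qed

text \<open>A representation of \<open>- 1\<close> as a sum of squares involves finitely many
  elements, so it cannot first appear in the union of a chain; Zorn's lemma applies.\<close>

lemma ex_maximal_formally_real_subfield:
  fixes S :: "'b::field set"
  assumes "subfield_set S" "- 1 \<notin> sum_squares S"
  obtains R where "S \<subseteq> R" "subfield_set R" "- 1 \<notin> sum_squares R"
    "\<And>T. subfield_set T \<Longrightarrow> - 1 \<notin> sum_squares T \<Longrightarrow> R \<subseteq> T \<Longrightarrow> T = R"
proof -
  define A where "A = {R. S \<subseteq> R \<and> subfield_set R \<and> - 1 \<notin> sum_squares R}"
  have "\<exists>M\<in>A. \<forall>X\<in>A. M \<subseteq> X \<longrightarrow> X = M"
  proof (rule subset_Zorn_nonempty)
    show "A \<noteq> {}" using assms by (auto simp: A_def)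
    fix C assume C: "C \<noteq> {}" "subset.chain A C"
    then have CA: "C \<subseteq> A" by (auto simp: subset_chain_def)
    then have "subfield_set (\<Union>C)"
      by (intro subfield_set_Union_chain [OF C(2,1)]) (auto simp: A_def)
    moreover have "- 1 \<notin> sum_squares (\<Union>C)"
      using sum_squares_Union_chain [OF C(2,1), of "- 1"] CA by (auto simp: A_def)
    moreover have "S \<subseteq> \<Union>C" using C(1) CA by (auto simp: A_def)
    ultimately show "\<Union>C \<in> A" by (simp add: A_def)
  qed
  then obtain R where "R \<in> A" "\<And>X. X \<in> A \<Longrightarrow> R \<subseteq> X \<Longrightarrow> X = R" by blast
  with that [of R] show ?thesis by (auto simp: A_def)
qed

section \<open>Square roots over a maximal formally real subfield\<close>

locale maximal_real_subfield =
  fixes R :: "'b::field set"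
  assumes R: "subfield_set R"
    and real: "- 1 \<notin> sum_squares R"
    and maximal: "\<And>T. subfield_set T \<Longrightarrow> - 1 \<notin> sum_squares T \<Longrightarrow> R \<subseteq> T \<Longrightarrow> T = R"
    and two: "(2::'b) \<noteq> 0"
    and ex_sqrt: "\<And>x::'b. \<exists>y. y * y = x"
begin

text \<open>Adjoining \<open>s\<close> enlarges \<open>R\<close>, so by maximality
  \<open>- 1\<close> becomes a sum of squares there; comparing the coordinates at 1 gives the
  equation in \<open>R\<close>.\<close>

lemma minus_one_in_sum_squares_adjoin:
  assumes "s * s \<in> R" "s \<notin> R"
  obtains p q where "p \<in> sum_squares R" "q \<in> sum_squares R" "- 1 = p + s * s * q"
proof -
  have "- 1 \<in> sum_squares (adjoin R s)"
    using maximal [OF subfield_set_adjoin [OF R assms(1)]] adjoin_base [OF R] adjoin_root [OF R] assms(2)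
    by blast
  then obtain p q t where pqt: "p \<in> sum_squares R" "q \<in> sum_squares R" "t \<in> R"
      "- 1 = (p + s * s * q) + t * s"
    by (rule sum_squares_adjoin [OF R])
  have "- 1 + 0 * s = (p + s * s * q) + t * s" using pqt(4) by simp
  have "- 1 = p + s * s * q"
    using pqt(1-3) assms(1) R sum_squares_subset [OF R]
    by (intro adjoin_unique(1) [OF R assms(2) _ _ _ _ \<open>- 1 + 0 * s = _\<close>]) (auto simp: subfield_setD)
  with pqt that show ?thesis by blast
qed

text \<open>Otherwise \<open>p + s * s * q\<close> would itself be a sum of squares in
  \<open>R\<close> equal to \<open>- 1\<close>.\<close>

lemma sqrt_sum_squares_in:
  assumes "s * s \<in> sum_squares R"
  shows "s \<in> R"
proof (rule ccontr)
  assume "s \<notin> R"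
  then obtain p q where "p \<in> sum_squares R" "q \<in> sum_squares R" "- 1 = p + s * s * q"
    using minus_one_in_sum_squares_adjoin sum_squares_subset [OF R assms] by blast
  with real assms show False
    by (simp add: sum_squares_add sum_squares_mult [OF R])
qed

text \<open>If \<open>s\<close> is outside \<open>R\<close>, then \<open>- (s * s)\<close> equals
  \<open>(p + 1) / q\<close>, a sum of squares, whose root \<open>u\<close> is in \<open>R\<close>.
  So each element of \<open>R\<close> is a square in \<open>R\<close> up to sign.\<close>

lemma sqrt_in_or:
  assumes "s * s \<in> R" "u * u = - (s * s)"
  shows "s \<in> R \<or> u \<in> R"
proof (rule disjCI)
  assume "u \<notin> R"
  show "s \<in> R"
  proof (rule ccontr)
    assume "s \<notin> R"
    then obtain p q where pq: "p \<in> sum_squares R" "q \<in> sum_squares R" "- 1 = p + s * s * q"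
      using minus_one_in_sum_squares_adjoin assms(1) by blast
    have "q \<noteq> 0" using pq real by auto
    have "s * s * q = - 1 - p" using pq(3) by (simp add: algebra_simps)
    then have "- (s * s) * q = p + 1 * 1" by simp
    then have "u * u = (p + 1 * 1) / q"
      using \<open>q \<noteq> 0\<close> by (simp add: assms(2) eq_divide_eq)
    also have "\<dots> \<in> sum_squares R"
      using pq R by (intro sum_squares_divide [OF R] sum_squares.step) (auto simp: subfield_setD)
    finally show False using sqrt_sum_squares_in \<open>u \<notin> R\<close> by blast
  qed
qed

lemma imaginary_unit_notin:
  assumes "j * j = - 1"
  shows "j \<notin> R"
  using sum_squares_square [of j R] real assms by auto

lemma square_eqD: "(u::'b) * u = v * v \<Longrightarrow> u = v \<or> u = - v"
  using square_eq_iff by blast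

text \<open>The usual formula for complex square roots, with \<open>u\<^sup>2 = (x \<plusminus> \<bar>z\<bar>) / 2\<close> for whichever sign makes
  the right-hand side a square.\<close>
lemma sqrt_in_adjoin_imaginary_unit:
  assumes j: "j * j = - 1" and z: "w * w \<in> adjoin R j"
  shows "w \<in> adjoin R j"
proof -
  obtain x y where xy: "x \<in> R" "y \<in> R" "w * w = x + y * j"
    using z by (auto simp: adjoin_def)
  have J: "a + b * j \<in> adjoin R j" if "a \<in> R" "b \<in> R" for a b using that by (rule adjoinI)
  have neg: "- a \<in> adjoin R j" if "a \<in> adjoin R j" for a
    using that subfield_set_adjoin [OF R, of j] R j by (simp add: subfield_setD)
  \<comment> \<open>Roots of the same element differ by a sign, so it suffices to exhibit one root
    in \<open>adjoin R j\<close>.\<close>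
  have W: "w \<in> adjoin R j" if "w * w = v * v" "v \<in> adjoin R j" for v
    using square_eqD [OF that(1)] that(2) neg by auto
  have jj: "(j * a) * (j * a) = - (a * a)" for a
  proof -
    have "(j * a) * (j * a) = (j * j) * (a * a)" by (simp only: ac_simps)
    then show ?thesis by (simp add: j)
  qed
  show ?thesis
  proof (cases "y = 0")
    case True
    \<comment> \<open>The square of \<open>j * w\<close> is the negative of \<open>w * w\<close>,
      which is now in \<open>R\<close>.\<close>
    consider "w \<in> R" | "j * w \<in> R"
      using sqrt_in_or [of w "j * w"] xy True jj by auto
    then show ?thesis
    proof cases
      case 1 then show ?thesis by (rule adjoin_base [OF R])
    next
      case 2
      have "w = 0 - (j * j) * w" by (simp add: j)
      also have "\<dots> = 0 + (- (j * w)) * j" by (simp add: ac_simps)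
      finally have "w = 0 + (- (j * w)) * j" .
      then show ?thesis using J [of 0 "- (j * w)"] 2 R by (simp add: subfield_setD)
    qed
  next
    case False
    \<comment> \<open>\<open>r\<close> serves as the absolute value of \<open>w * w\<close>; it is
      in \<open>R\<close> because its square is a sum of squares.\<close>
    obtain r where r: "r * r = x * x + y * y" using ex_sqrt by blast
    have "x * x + y * y \<in> sum_squares R" using xy by (simp add: sum_squares_add sum_squares_square)
    then have rR: "r \<in> R" using sqrt_sum_squares_in r by simp
    have *: "w \<in> adjoin R j" if r': "r' * r' = x * x + y * y" "u * u = (x + r') / 2" "u \<in> R" for u r'
    proof -
      have "u \<noteq> 0"
      proof
        assume "u = 0"
        with r'(2) two have "r' = - x" by (simp add: add_eq_0_iff)
        with r' False show False by simp
      qed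
      \<comment> \<open>Forced by comparing the coefficients of \<open>j\<close> in
        \<open>(u + v * j) * (u + v * j) = x + y * j\<close>. Then
        \<open>v * v = (r' - x) / 2\<close>, so the real parts agree as well.\<close>
      define v where "v = y / (2 * u)"
      have v2: "v * v = (y * y) / (2 * (2 * (u * u)))" by (simp add: v_def algebra_simps)
      have "2 * (u * u) = x + r'" using r'(2) two by (simp add: mult.commute)
      have "x + r' \<noteq> 0" using \<open>2 * (u * u) = x + r'\<close> \<open>u \<noteq> 0\<close> two by (metis mult_eq_0_iff)
      have "v * v = (y * y) / ((x + r') * 2)"
        by (simp only: v2 \<open>2 * (u * u) = x + r'\<close> mult.commute [of 2 "x + r'"])
      also have "y * y = (x + r') * (r' - x)" using r'(1) by (simp add: algebra_simps)
      also have "(x + r') * (r' - x) / ((x + r') * 2) = (r' - x) / 2"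
        using \<open>x + r' \<noteq> 0\<close> by (rule mult_divide_mult_cancel_left)
      finally have "v * v = (r' - x) / 2" .
      then have "u * u - v * v = ((x + r') - (r' - x)) / 2" by (simp only: r'(2) diff_divide_distrib)
      also have "x + r' - (r' - x) = 2 * x" by algebra
      also have "2 * x / 2 = x" using two by (rule nonzero_mult_div_cancel_left)
      finally have uv: "u * u - v * v = x" .
      have y: "2 * (u * v) = y" using \<open>u \<noteq> 0\<close> two by (simp add: v_def)
      have "(u + v * j) * (u + v * j) = u * u + v * v * (j * j) + 2 * (u * v) * j"
        by algebra
      also have "\<dots> = (u * u - v * v) + 2 * (u * v) * j" by (simp add: j)
      also have "\<dots> = w * w" by (simp only: uv y xy)
      finally have "w * w = (u + v * j) * (u + v * j)" by (rule sym)
      moreover have "v \<in> R"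
        using r'(3) xy R subfield_setD(3) [OF R, of 1 1] by (simp add: v_def subfield_setD)
      ultimately show ?thesis using W J r'(3) by blast
    qed
    obtain u where u: "u * u = (x + r) / 2" using ex_sqrt by blast
    show ?thesis
    proof (cases "u \<in> R")
      case True
      then show ?thesis using * [OF r u] by simp
    next
      case notin: False
      have twoR: "2 \<in> R" using subfield_setD(3) [OF R, of 1 1] R by (simp add: subfield_setD)
      \<comment> \<open>If \<open>u\<close> fails, then \<open>j * u\<close> is in \<open>R\<close>,
        and the root \<open>t\<close> for the opposite sign of \<open>r\<close> satisfies
        \<open>(j * u) * t = y / 2\<close> up to sign. Hence \<open>t\<close> is in
        \<open>R\<close>.\<close>
      obtain t where t: "t * t = (x + (- r)) / 2" using ex_sqrt by blast
      have "((u * t) * (u * t)) = ((x + r) / 2) * ((x + (- r)) / 2)"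
        unfolding u [symmetric] t [symmetric] by (simp only: ac_simps)
      also have "\<dots> = ((x + r) * (x + (- r))) / (2 * 2)" by (rule times_divide_times_eq)
      also have "(x + r) * (x + (- r)) = - (y * y)" using r by algebra
      also have "- (y * y) / (2 * 2) = - ((y / 2) * (y / 2))"
        by (simp only: times_divide_times_eq minus_divide_left)
      finally have ut: "(u * t) * (u * t) = - ((y / 2) * (y / 2))" .
      have juR: "j * u \<in> R"
        using sqrt_in_or [of u "j * u"] jj notin u rR xy twoR R by (auto simp: subfield_setD)
      have "((j * u) * t) * ((j * u) * t) = (j * j) * ((u * t) * (u * t))" by (simp only: ac_simps)
      then have "((j * u) * t) * ((j * u) * t) = (y / 2) * (y / 2)"
        by (simp only: ut j mult_minus_left mult_minus_right mult_1_left minus_minus)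
      then have jut: "(j * u) * t = y / 2 \<or> (j * u) * t = - (y / 2)" by (rule square_eqD)
      then have "j * u \<noteq> 0" using False two by auto
      with jut have "t = (y / 2) / (j * u) \<or> t = (- (y / 2)) / (j * u)"
        by (metis nonzero_mult_div_cancel_left)
      moreover have "y / 2 \<in> R" using xy twoR R by (simp add: subfield_setD)
      ultimately have "t \<in> R" using juR R by (metis subfield_setD(5) subfield_setD(8))
      then show ?thesis using * [OF _ t] r by simp
    qed
  qed
qed

end

section \<open>The W-group\<close>

text \<open>The generating set of \<open>W_kernel\<close>, for an abstract group.\<close>

definition W_gens :: "('g, 'm) monoid_scheme \<Rightarrow> 'g set" where
  "W_gens G = {\<sigma> [^]\<^bsub>G\<^esub> (4::nat) | \<sigma>. \<sigma> \<in> carrier G} \<union>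
     {(\<sigma> [^]\<^bsub>G\<^esub> (2::nat)) \<otimes>\<^bsub>G\<^esub> \<tau> \<otimes>\<^bsub>G\<^esub> inv\<^bsub>G\<^esub> (\<sigma> [^]\<^bsub>G\<^esub> (2::nat)) \<otimes>\<^bsub>G\<^esub> inv\<^bsub>G\<^esub> \<tau>
       | \<sigma> \<tau>. \<sigma> \<in> carrier G \<and> \<tau> \<in> carrier G}"

text \<open>The triple \<open>(b, a, h)\<close> is a homomorphism to the dihedral group of order eight, viewed as the
  central extension of the Klein four-group by the cocycle \<open>b \<union> a\<close>.\<close>
definition twisted :: "('g, 'm) monoid_scheme \<Rightarrow> ('g \<Rightarrow> bit) \<Rightarrow> ('g \<Rightarrow> bit) \<Rightarrow> ('g \<Rightarrow> bit) \<Rightarrow> bool" where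
  "twisted G b a h \<longleftrightarrow> additive G a \<and> additive G b \<and>
     (\<forall>\<sigma>\<in>carrier G. \<forall>\<tau>\<in>carrier G. h (\<sigma> \<otimes>\<^bsub>G\<^esub> \<tau>) = h \<sigma> + h \<tau> + b \<sigma> * a \<tau>)"

text \<open>The degenerate case with zero cocycle, through which the descent results for
  \<open>twisted\<close> also cover characters.\<close>

lemma additive_imp_twisted: "additive G h \<Longrightarrow> twisted G (\<lambda>_. 0) (\<lambda>_. 0) h"
  by (simp add: twisted_def additive_def)

text \<open>Chooses the representative exactly as \<open>x_class\<close> does.\<close>

definition lift_coset :: "('g \<Rightarrow> bit) \<Rightarrow> 'g set \<Rightarrow> bit" where
  "lift_coset h C = h (SOME \<sigma>. \<sigma> \<in> C)"

context group
begin

lemma conj_mult: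
  assumes "x \<in> carrier G" "s \<in> carrier G" "t \<in> carrier G"
  shows "x \<otimes> (s \<otimes> t) \<otimes> inv x = (x \<otimes> s \<otimes> inv x) \<otimes> (x \<otimes> t \<otimes> inv x)"
proof -
  have "(x \<otimes> s \<otimes> inv x) \<otimes> (x \<otimes> t \<otimes> inv x) = x \<otimes> s \<otimes> (inv x \<otimes> x) \<otimes> t \<otimes> inv x"
    using assms by (simp only: m_assoc m_closed inv_closed)
  with assms show ?thesis by (simp add: m_assoc)
qed

lemma conj_pow:
  assumes "x \<in> carrier G" "s \<in> carrier G"
  shows "x \<otimes> s [^] (n::nat) \<otimes> inv x = (x \<otimes> s \<otimes> inv x) [^] n"
  by (induction n) (use assms in \<open>simp_all add: conj_mult\<close>)

lemma conj_inv:
  assumes "x \<in> carrier G" "s \<in> carrier G"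
  shows "x \<otimes> inv s \<otimes> inv x = inv (x \<otimes> s \<otimes> inv x)"
  using assms by (simp add: inv_mult_group m_assoc)

lemma W_gens_subset: "W_gens G \<subseteq> carrier G"
  by (auto simp: W_gens_def)

text \<open>Conjugation respects powers, products and inverses, so the generating set is already
  stable under it.\<close>

lemma normal_generate_W_gens: "generate G (W_gens G) \<lhd> G"
proof (rule normal_generateI [OF W_gens_subset])
  fix h x assume h: "h \<in> W_gens G" and x: "x \<in> carrier G"
  from h consider s where "s \<in> carrier G" "h = s [^] (4::nat)"
    | s t where "s \<in> carrier G" "t \<in> carrier G"
        "h = (s [^] (2::nat)) \<otimes> t \<otimes> inv (s [^] (2::nat)) \<otimes> inv t"
    unfolding W_gens_def by blast
  then show "x \<otimes> h \<otimes> inv x \<in> W_gens G"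
  proof cases
    case 1
    then have "x \<otimes> h \<otimes> inv x = (x \<otimes> s \<otimes> inv x) [^] (4::nat)"
      using x by (simp add: conj_pow)
    with 1 x show ?thesis unfolding W_gens_def by blast
  next
    case 2
    let ?s = "x \<otimes> s \<otimes> inv x" and ?t = "x \<otimes> t \<otimes> inv x"
    have "x \<otimes> h \<otimes> inv x = (?s [^] (2::nat)) \<otimes> ?t \<otimes> inv (?s [^] (2::nat)) \<otimes> inv ?t"
      by (simp add: 2 x conj_mult [OF x] conj_pow [OF x] conj_inv [OF x]
          del: inv_mult_group nat_pow_Suc)
    moreover have "?s \<in> carrier G" "?t \<in> carrier G" using 2 x by auto
    ultimately show ?thesis unfolding W_gens_def by blast
  qed
qed

section \<open>Descent of characters and dihedral cochains to the quotient\<close>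

lemma additive_one: "additive G a \<Longrightarrow> a \<one> = 0"
  unfolding additive_def by (metis bit_add_self one_closed r_one)

lemma additive_inv: "additive G a \<Longrightarrow> x \<in> carrier G \<Longrightarrow> a (inv x) = a x"
  using additive_one [of a] r_inv [of x] inv_closed [of x] unfolding additive_def
  by (metis bit_add_eq_0_iff)

context
  fixes a b h :: "'a \<Rightarrow> bit"
  assumes tw: "twisted G b a h"
begin

lemma twisted_simps:
  shows "x \<in> carrier G \<Longrightarrow> y \<in> carrier G \<Longrightarrow> a (x \<otimes> y) = a x + a y"
    "x \<in> carrier G \<Longrightarrow> y \<in> carrier G \<Longrightarrow> b (x \<otimes> y) = b x + b y"
    "x \<in> carrier G \<Longrightarrow> y \<in> carrier G \<Longrightarrow> h (x \<otimes> y) = h x + h y + b x * a y"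
    "a \<one> = 0" "b \<one> = 0"
    "x \<in> carrier G \<Longrightarrow> a (inv x) = a x" "x \<in> carrier G \<Longrightarrow> b (inv x) = b x"
  using tw additive_one additive_inv by (auto simp: twisted_def additive_def)

lemma twisted_one: "h \<one> = 0"
  using twisted_simps(3) [of \<one> \<one>] twisted_simps(4) by simp

lemma twisted_inv:
  assumes "x \<in> carrier G"
  shows "h (inv x) = h x + b x * a x"
proof -
  have "h x + h (inv x) + b x * a (inv x) = 0"
    using twisted_simps(3) [of x "inv x"] assms twisted_one by simp
  then have "h x + (h (inv x) + b x * a x) = 0"
    using assms twisted_simps by (metis add.assoc)
  then show ?thesis by (metis add.commute bit_add_eq_0_iff bit_add_self_left)
qed

text \<open>The common zero set is the kernel of the homomorphism to the dihedral group. It contains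
  the generators since that group has exponent four and central squares.\<close>

lemma twisted_generate_W_gens:
  assumes "x \<in> generate G (W_gens G)"
  shows "a x = 0 \<and> b x = 0 \<and> h x = 0"
proof -
  let ?K = "{x \<in> carrier G. a x = 0 \<and> b x = 0 \<and> h x = 0}"
  have "subgroup ?K G"
    by (rule subgroupI) (auto simp: twisted_simps twisted_one twisted_inv intro!: exI [of _ \<one>])
  have "W_gens G \<subseteq> ?K"
  proof
    fix y assume y: "y \<in> W_gens G"
    have sq: "s [^] (2::nat) = s \<otimes> s" if "s \<in> carrier G" for s
      using that by (simp add: numeral_2_eq_2)
    have qu: "s [^] (4::nat) = (s \<otimes> s) \<otimes> (s \<otimes> s)" if "s \<in> carrier G" for s
      using that nat_pow_mult [of s 2 2] by (simp add: sq)
    from y consider s where "s \<in> carrier G" "y = s [^] (4::nat)"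
      | s t where "s \<in> carrier G" "t \<in> carrier G"
          "y = (s [^] (2::nat)) \<otimes> t \<otimes> inv (s [^] (2::nat)) \<otimes> inv t"
      unfolding W_gens_def by blast
    then show "y \<in> ?K"
    proof cases
      case 1
      then show ?thesis by (simp add: qu twisted_simps)
    next
      case 2
      then show ?thesis
        by (simp add: sq twisted_simps twisted_inv algebra_simps del: inv_mult_group)
    qed
  qed
  with \<open>subgroup ?K G\<close> have "generate G (W_gens G) \<subseteq> ?K"
    by (intro generate_subgroup_incl)
  with assms show ?thesis by auto
qed

text \<open>The chosen representative is \<open>k \<otimes> x\<close> with \<open>a\<close>,
  \<open>b\<close> and \<open>h\<close> all zero at \<open>k\<close>, so the twisted product formula
  leaves \<open>h x\<close>.\<close>

lemma lift_coset_twisted: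
  assumes "x \<in> carrier G"
  shows "lift_coset h (generate G (W_gens G) #> x) = h x"
proof -
  let ?N = "generate G (W_gens G)"
  have sub: "subgroup ?N G" by (rule generate_is_subgroup [OF W_gens_subset])
  have "(SOME y. y \<in> ?N #> x) \<in> ?N #> x"
    by (rule someI) (rule rcos_self [OF assms sub])
  then obtain k where k: "k \<in> ?N" "(SOME y. y \<in> ?N #> x) = k \<otimes> x"
    unfolding r_coset_def by blast
  then have "k \<in> carrier G" using subgroup.mem_carrier [OF sub] by simp
  then show ?thesis
    using twisted_generate_W_gens [OF k(1)] assms
    unfolding lift_coset_def k(2) by (simp add: twisted_simps)
qed

lemma lift_coset_twisted_mult:
  assumes "C \<in> carrier (G Mod generate G (W_gens G))" "D \<in> carrier (G Mod generate G (W_gens G))"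
  shows "lift_coset h (C \<otimes>\<^bsub>G Mod generate G (W_gens G)\<^esub> D) =
     lift_coset h C + lift_coset h D + lift_coset b C * lift_coset a D"
proof -
  obtain x y where "x \<in> carrier G" "y \<in> carrier G"
    "C = generate G (W_gens G) #> x" "D = generate G (W_gens G) #> y"
    using assms by (auto simp: carrier_FactGroup)
  moreover have "lift_coset a (generate G (W_gens G) #> z) = a z"
    "lift_coset b (generate G (W_gens G) #> z) = b z" if "z \<in> carrier G" for z
    using tw that by (auto simp: twisted_def
        intro: group.lift_coset_twisted [OF is_group additive_imp_twisted])
  ultimately show ?thesis
    by (simp add: normal.rcos_sum [OF normal_generate_W_gens] lift_coset_twisted twisted_simps)
qed

end

lemma additive_lift_coset:
  "additive G a \<Longrightarrow> additive (G Mod generate G (W_gens G)) (lift_coset a)"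
  using lift_coset_twisted_mult [OF additive_imp_twisted]
  unfolding additive_def lift_coset_def [of "\<lambda>_. 0"] by (metis add_0_right mult_zero_left)

end

section \<open>Square roots and characters of the Galois group\<close>

locale quadratic_closure =
  fixes i :: "'a::field \<Rightarrow> 'b::field"
  assumes two: "(2::'a) \<noteq> 0"
    and closure: "is_quadratic_closure i"
begin

lemmas closure_unfolded = closure [unfolded is_quadratic_closure_def]

lemma i_add: "i (x + y) = i x + i y"
  by (rule closure_unfolded [THEN conjunct1, rule_format])

lemma i_mult: "i (x * y) = i x * i y"
  by (rule closure_unfolded [THEN conjunct2, THEN conjunct1, rule_format])

lemma i_one: "i 1 = 1"
  by (rule closure_unfolded [THEN conjunct2, THEN conjunct2, THEN conjunct1])

lemma ex_sqrt: "\<exists>y. y * y = (z::'b)"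
  by (rule closure_unfolded [THEN conjunct2, THEN conjunct2, THEN conjunct2, THEN conjunct1, rule_format])

lemma i_zero: "i 0 = 0"
  using i_add [of 0 0] by (metis add_0_right add_left_cancel)

lemma i_minus: "i (- x) = - i x"
  using i_add [of x "- x"] by (simp add: i_zero eq_neg_iff_add_eq_0 add.commute)

lemma i_eq_0_iff: "i x = 0 \<longleftrightarrow> x = 0"
proof
  assume "i x = 0"
  then have "i (x * inverse x) = 0" by (simp only: i_mult mult_zero_left)
  then show "x = 0" using i_one by (metis right_inverse zero_neq_one)
qed (simp add: i_zero)

lemma i_inverse: "i (inverse x) = inverse (i x)"
proof (cases "x = 0")
  case False
  then have "i x * i (inverse x) = 1" using i_mult [of x "inverse x"] by (simp add: i_one)
  then show ?thesis by (metis inverse_unique)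
qed (simp add: i_zero)

lemma two': "(2::'b) \<noteq> 0"
proof -
  have "i 2 = 2" using i_add [of 1 1] by (simp add: i_one)
  then show ?thesis using i_eq_0_iff [of 2] two by simp
qed

lemma UNIV_if_sqrt_closed:
  assumes "subfield_set S" "\<And>a. i a \<in> S" "\<And>x y. x \<in> S \<Longrightarrow> y * y = x \<Longrightarrow> y \<in> S"
  shows "S = UNIV"
  by (rule closure_unfolded [THEN conjunct2, THEN conjunct2, THEN conjunct2, THEN conjunct2,
        THEN spec, THEN mp])
     (use assms in \<open>auto simp: subfield_set_def\<close>)

abbreviation "G \<equiv> galois_group i"
abbreviation "N \<equiv> generate G (W_gens G)"

lemma galD:
  assumes "\<sigma> \<in> carrier G"
  shows "bij \<sigma>" "\<sigma> (x + y) = \<sigma> x + \<sigma> y" "\<sigma> (x * y) = \<sigma> x * \<sigma> y" "\<sigma> (i c) = i c"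
  using assms by (auto simp: galois_group_def gal_aut_def)

lemma gal_zero: "\<sigma> \<in> carrier G \<Longrightarrow> \<sigma> 0 = 0"
  using galD(4) [of \<sigma> 0] by (simp add: i_zero)

lemma gal_one: "\<sigma> \<in> carrier G \<Longrightarrow> \<sigma> 1 = 1"
  using galD(4) [of \<sigma> 1] by (simp add: i_one)

lemma gal_minus: "\<sigma> \<in> carrier G \<Longrightarrow> \<sigma> (- x) = - \<sigma> x"
  using galD(2) [of \<sigma> x "- x"] by (simp add: gal_zero eq_neg_iff_add_eq_0 add.commute)

lemma gal_divide: "\<sigma> \<in> carrier G \<Longrightarrow> \<sigma> (x / y) = \<sigma> x / \<sigma> y"
proof (cases "y = 0")
  case False
  assume s: "\<sigma> \<in> carrier G"
  have "\<sigma> y \<noteq> 0"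
    using False gal_zero [OF s] galD(1) [OF s] by (metis bij_is_inj injD)
  then show ?thesis using galD(3) [OF s, of "x / y" y] False by (simp add: field_simps)
qed (simp add: gal_zero)

lemma mult_G [simp]: "\<sigma> \<otimes>\<^bsub>G\<^esub> \<tau> = \<sigma> \<circ> \<tau>" and one_G [simp]: "\<one>\<^bsub>G\<^esub> = id"
  by (simp_all add: galois_group_def)

lemma group_G: "group G"
proof (rule groupI)
  show "\<sigma> \<otimes>\<^bsub>G\<^esub> \<tau> \<in> carrier G" if "\<sigma> \<in> carrier G" "\<tau> \<in> carrier G" for \<sigma> \<tau>
    using that by (auto simp: galois_group_def gal_aut_def intro: bij_comp)
  show "\<one>\<^bsub>G\<^esub> \<in> carrier G" by (simp add: galois_group_def gal_aut_def)
  show "\<exists>\<tau>\<in>carrier G. \<tau> \<otimes>\<^bsub>G\<^esub> \<sigma> = \<one>\<^bsub>G\<^esub>" if "\<sigma> \<in> carrier G" for \<sigma>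
  proof (rule bexI)
    note s = galD [OF that]
    have eq: "inv_into UNIV \<sigma> x = y \<longleftrightarrow> x = \<sigma> y" for x y
      using s(1) by (metis bij_inv_eq_iff)
    have inv: "\<sigma> (inv_into UNIV \<sigma> x) = x" for x
      using eq by metis
    show "inv_into UNIV \<sigma> \<in> carrier G"
      using s bij_imp_bij_inv [OF s(1)]
      by (auto simp: galois_group_def gal_aut_def eq inv)
    show "inv_into UNIV \<sigma> \<otimes>\<^bsub>G\<^esub> \<sigma> = \<one>\<^bsub>G\<^esub>"
      using s(1) by (simp add: bij_is_inj)
  qed
qed (auto simp: comp_assoc)

lemma W_group_eq: "W_group i = G Mod N"
  by (simp add: W_group_def W_kernel_def W_gens_def Let_def)

lemma minus_one_neq_one: "- 1 \<noteq> (1::'b)" "1 \<noteq> (- 1 :: 'b)"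
  using two' by (metis add.left_inverse one_add_one)+

text \<open>Turns additive bits into the signs by which automorphisms act on square roots.\<close>

definition sg :: "bit \<Rightarrow> 'b" where
  "sg e = (if e = 0 then 1 else - 1)"

lemma sg_add: "sg (d + e) = sg d * sg e"
  by (cases d; cases e) (auto simp: sg_def)

lemma sg_inj: "sg d = sg e \<Longrightarrow> d = e"
  using minus_one_neq_one by (cases d; cases e) (auto simp: sg_def)

lemma gal_sg: "\<sigma> \<in> carrier G \<Longrightarrow> \<sigma> (sg e * z) = sg e * \<sigma> z"
  using gal_minus [of \<sigma> z] by (simp add: sg_def)

text \<open>The Kummer character on the Galois group itself, with the same choice of root as
  \<open>x_class\<close>.\<close>

definition chi :: "'a \<Rightarrow> ('b \<Rightarrow> 'b) \<Rightarrow> bit" where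
  "chi c \<sigma> = (let r = (SOME r. r * r = i c) in if \<sigma> r = r then 0 else 1)"

lemma x_class_eq: "x_class i c = lift_coset (chi c)"
  by (simp add: fun_eq_iff x_class_def lift_coset_def chi_def Let_def)

text \<open>The sign does not depend on the root: another root differs from the chosen one by a
  sign, which \<sigma> preserves.\<close>

lemma gal_sqrt:
  assumes "\<sigma> \<in> carrier G" "r * r = i c"
  shows "\<sigma> r = sg (chi c \<sigma>) * r"
proof -
  define q where "q = (SOME r. r * r = i c)"
  have q: "q * q = i c" unfolding q_def using assms(2) by (rule someI)
  have chi: "chi c \<sigma> = (if \<sigma> q = q then 0 else 1)" by (simp only: chi_def q_def Let_def)
  have "\<sigma> q * \<sigma> q = q * q"
    using galD(3) [OF assms(1), of q q] galD(4) [OF assms(1), of c] by (simp only: q)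
  then have "\<sigma> q = q \<or> \<sigma> q = - q" by (simp only: square_eq_iff)
  then have *: "\<sigma> q = sg (chi c \<sigma>) * q" by (auto simp: chi sg_def)
  have "r = q \<or> r = - q" using assms(2) q by (metis square_eq_iff)
  then show ?thesis
  proof
    assume "r = - q"
    then show ?thesis by (simp only: gal_minus [OF assms(1)] * mult_minus_right)
  qed (simp only: *)
qed

lemma chi_eqI:
  assumes "\<sigma> \<in> carrier G" "c \<noteq> 0" "r * r = i c" "\<sigma> r = sg e * r"
  shows "chi c \<sigma> = e"
proof -
  have "r \<noteq> 0" using assms(2,3) i_eq_0_iff [of c] by auto
  then have "sg (chi c \<sigma>) = sg e"
    using gal_sqrt [OF assms(1,3)] assms(4) \<open>r \<noteq> 0\<close> by (metis mult_right_cancel)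
  then show ?thesis by (rule sg_inj)
qed

lemma chi_mult:
  assumes "\<sigma> \<in> carrier G" "c \<noteq> 0" "d \<noteq> 0"
  shows "chi (c * d) \<sigma> = chi c \<sigma> + chi d \<sigma>"
proof -
  obtain r s where rs: "r * r = i c" "s * s = i d" using ex_sqrt by metis
  have "\<sigma> (r * s) = (sg (chi c \<sigma>) * r) * (sg (chi d \<sigma>) * s)"
    by (simp only: galD(3) [OF assms(1)] gal_sqrt [OF assms(1) rs(1)] gal_sqrt [OF assms(1) rs(2)])
  then have "\<sigma> (r * s) = sg (chi c \<sigma> + chi d \<sigma>) * (r * s)"
    by (simp only: sg_add ac_simps)
  moreover have "(r * s) * (r * s) = i (c * d)"
    unfolding i_mult rs [symmetric] by (simp only: ac_simps)
  moreover have "c * d \<noteq> 0" using assms(2,3) by simp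
  ultimately show ?thesis by (metis chi_eqI assms(1))
qed

lemma chi_one: "\<sigma> \<in> carrier G \<Longrightarrow> chi 1 \<sigma> = 0"
  using chi_eqI [of \<sigma> 1 1 0] gal_one [of \<sigma>] by (simp add: i_one sg_def)

lemma additive_chi:
  assumes "c \<noteq> 0"
  shows "additive G (chi c)"
  unfolding additive_def
proof (intro ballI)
  fix \<sigma> \<tau> assume st: "\<sigma> \<in> carrier G" "\<tau> \<in> carrier G"
  obtain r where r: "r * r = i c" using ex_sqrt by metis
  have "(\<sigma> \<otimes>\<^bsub>G\<^esub> \<tau>) r = sg (chi c \<tau> + chi c \<sigma>) * r"
    by (simp add: gal_sqrt [OF st(1) r] gal_sqrt [OF st(2) r] gal_sg [OF st(1)] sg_add)
  then have "chi c (\<sigma> \<otimes>\<^bsub>G\<^esub> \<tau>) = chi c \<tau> + chi c \<sigma>"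
    by (rule chi_eqI [OF monoid.m_closed [OF group.is_monoid [OF group_G] st] assms r])
  then show "chi c (\<sigma> \<otimes>\<^bsub>G\<^esub> \<tau>) = chi c \<sigma> + chi c \<tau>"
    by (simp only: add.commute)
qed

text \<open>With \<open>\<gamma> = \<surd>(1 + \<surd>c)\<close> the conjugates of \<open>\<gamma>\<close> are \<open>\<plusminus>\<gamma>\<close> and \<open>\<plusminus>\<surd>d/\<gamma>\<close>, because \<open>1 - c = d\<close>.
  The sign defines the cochain \<open>h\<close>.\<close>
lemma ex_twisted_chi:
  assumes "c + d = 1" "c \<noteq> 0" "d \<noteq> 0"
  obtains h where "twisted G (chi d) (chi c) h"
proof -
  obtain r s g where r: "r * r = i c" and s: "s * s = i d" and g: "g * g = 1 + r"
    using ex_sqrt by metis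
  have "i c + i d = 1" using i_add [of c d] assms(1) by (simp add: i_one)
  then have rs: "(1 + r) * (1 - r) = s * s" unfolding r [symmetric] s [symmetric] by algebra
  have "s \<noteq> 0" using s assms(3) i_eq_0_iff [of d] by (metis mult_zero_left)
  with rs have "1 + r \<noteq> 0" by (metis mult_eq_0_iff)
  with g have "g \<noteq> 0" by (metis mult_zero_left)
  \<comment> \<open>One conjugate of \<open>g\<close> over each of the two values
    \<open>1 + r\<close> and \<open>1 - r\<close>; the index is the bit by which an automorphism
    moves \<open>r\<close>.\<close>
  define gam where "gam e = (if e = 0 then g else s / g)" for e :: bit
  have gam_nz: "gam e \<noteq> 0" for e using \<open>g \<noteq> 0\<close> \<open>s \<noteq> 0\<close> by (simp add: gam_def)
  have gam_sq: "gam e * gam e = 1 + sg e * r" for e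
  proof (cases "e = 0")
    case False
    have "gam e * gam e = (s * s) / (1 + r)" using False by (simp add: gam_def g)
    also have "\<dots> = 1 - r" using \<open>1 + r \<noteq> 0\<close> by (simp flip: rs)
    finally show ?thesis using False by (simp add: sg_def)
  qed (simp add: gam_def g sg_def)
  have gam_swap: "s / gam e = gam (e + 1)" for e
    using \<open>g \<noteq> 0\<close> \<open>s \<noteq> 0\<close> by (cases e) (auto simp: gam_def)
  have "\<exists>e. \<sigma> g = sg e * gam (chi c \<sigma>)" if "\<sigma> \<in> carrier G" for \<sigma>
  proof -
    have "\<sigma> g * \<sigma> g = \<sigma> (1 + r)" using galD(3) [OF that] g by metis
    also have "\<dots> = gam (chi c \<sigma>) * gam (chi c \<sigma>)"
      by (simp add: gam_sq galD(2) [OF that] gal_one [OF that] gal_sqrt [OF that r])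
    finally have "\<sigma> g = gam (chi c \<sigma>) \<or> \<sigma> g = - gam (chi c \<sigma>)" by (simp add: square_eq_iff)
    then have "\<sigma> g = sg 0 * gam (chi c \<sigma>) \<or> \<sigma> g = sg 1 * gam (chi c \<sigma>)" by (simp add: sg_def)
    then show ?thesis by blast
  qed
  then obtain h where h: "\<And>\<sigma>. \<sigma> \<in> carrier G \<Longrightarrow> \<sigma> g = sg (h \<sigma>) * gam (chi c \<sigma>)" by metis
  have "h (\<sigma> \<otimes>\<^bsub>G\<^esub> \<tau>) = h \<sigma> + h \<tau> + chi d \<sigma> * chi c \<tau>"
    if st: "\<sigma> \<in> carrier G" "\<tau> \<in> carrier G" for \<sigma> \<tau>
  proof -
    have mem: "\<sigma> \<otimes>\<^bsub>G\<^esub> \<tau> \<in> carrier G"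
      using monoid.m_closed [OF group.is_monoid [OF group_G] st] .
    have chi_st: "chi c (\<sigma> \<otimes>\<^bsub>G\<^esub> \<tau>) = chi c \<sigma> + chi c \<tau>"
      using additive_chi [OF assms(2)] st unfolding additive_def by blast
    \<comment> \<open>If \<tau> moves \<open>r\<close>, then \<sigma> is applied to
      \<open>s / g\<close>. Its numerator contributes the sign of \<open>chi d \<sigma>\<close>,
      which is the source of the cocycle term.\<close>
    have "\<sigma> (gam (chi c \<tau>)) = sg (h \<sigma> + chi d \<sigma> * chi c \<tau>) * gam (chi c \<sigma> + chi c \<tau>)"
    proof (cases "chi c \<tau> = 0")
      case True
      then show ?thesis using h [OF st(1)] by (simp add: gam_def [of 0])
    next
      case False
      have "\<sigma> (gam 1) = (sg (chi d \<sigma>) * s) / (sg (h \<sigma>) * gam (chi c \<sigma>))"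
        by (simp add: gam_def [of 1] gal_divide [OF st(1)] gal_sqrt [OF st(1) s] h [OF st(1)])
      also have "\<dots> = sg (chi d \<sigma>) * sg (h \<sigma>) * (s / gam (chi c \<sigma>))"
        by (simp add: sg_def)
      finally show ?thesis using False by (simp add: gam_swap sg_add)
    qed
    then have "(\<sigma> \<otimes>\<^bsub>G\<^esub> \<tau>) g = sg (h \<sigma> + h \<tau> + chi d \<sigma> * chi c \<tau>) * gam (chi c \<sigma> + chi c \<tau>)"
      by (simp add: h [OF st(2)] gal_sg [OF st(1)] sg_add)
    with h [OF mem] chi_st gam_nz show ?thesis
      by (metis mult_right_cancel sg_inj)
  qed
  then have "twisted G (chi d) (chi c) h"
    using additive_chi assms(2,3) unfolding twisted_def by blast
  then show ?thesis by (rule that)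
qed

end

section \<open>Products of Kummer classes over the W-group\<close>

context quadratic_closure
begin

abbreviation "W \<equiv> G Mod N"
abbreviation "X c \<equiv> lift_coset (chi c)"

lemma X_coset: "\<sigma> \<in> carrier G \<Longrightarrow> c \<noteq> 0 \<Longrightarrow> X c (N #>\<^bsub>G\<^esub> \<sigma>) = chi c \<sigma>"
  by (rule group.lift_coset_twisted [OF group_G additive_imp_twisted [OF additive_chi]])

lemma carrier_WE:
  assumes "C \<in> carrier W"
  obtains \<sigma> where "\<sigma> \<in> carrier G" "C = N #>\<^bsub>G\<^esub> \<sigma>"
  using assms by (auto simp: carrier_FactGroup)

lemma X_mult: "C \<in> carrier W \<Longrightarrow> c \<noteq> 0 \<Longrightarrow> d \<noteq> 0 \<Longrightarrow> X (c * d) C = X c C + X d C"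
  by (elim carrier_WE) (simp add: X_coset chi_mult)

lemma X_one: "C \<in> carrier W \<Longrightarrow> X 1 C = 0"
  by (elim carrier_WE) (simp add: X_coset chi_one)

lemma X_mult_square:
  assumes "C \<in> carrier W" "c \<noteq> 0" "d \<noteq> 0"
  shows "X (c * (d * d)) C = X c C"
proof -
  have "X (c * (d * d)) C = X c C + (X d C + X d C)"
    using assms X_mult [of C c "d * d"] X_mult [of C d d] by simp
  then show ?thesis by (simp only: bit_add_self add_0_right)
qed

lemma X_inverse:
  assumes "C \<in> carrier W" "c \<noteq> 0"
  shows "X (inverse c) C = X c C"
  using X_mult_square [OF assms, of "inverse c"] assms(2) by (simp add: mult.assoc [symmetric])

lemma additive_X: "c \<noteq> 0 \<Longrightarrow> additive W (X c)"
  by (rule group.additive_lift_coset [OF group_G additive_chi])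

text \<open>The dihedral cochain over the Galois group descends to the quotient and bounds the
  product there. Exchanging \<open>c\<close> and \<open>d\<close> puts the factors in the stated
  order.\<close>

lemma X_Steinberg:
  assumes "c + d = 1" "c \<noteq> 0" "d \<noteq> 0"
  shows "is_coboundary W 2 (\<lambda>gs. X c (gs ! 0) * X d (gs ! 1))"
proof -
  obtain h where "twisted G (chi c) (chi d) h"
    using ex_twisted_chi [of d c] assms by (metis add.commute)
  then show ?thesis
    by (intro is_coboundary_2I [where h = "lift_coset h" and c = "\<lambda>g g'. X c g * X d g'"]
        group.lift_coset_twisted_mult [OF group_G])
qed

text \<open>Writing \<open>- c = (1 - c) / (1 - 1/c)\<close> reduces this to two Steinberg relations.\<close>
lemma X_minus:
  assumes "c \<noteq> 0"
  shows "is_coboundary W 2 (\<lambda>gs. X c (gs ! 0) * X (- c) (gs ! 1))"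
proof (cases "c = 1")
  \<comment> \<open>Here \<open>1 - c\<close> vanishes and has no class, but \<open>X 1\<close> is
    zero on the W-group.\<close>
  case True
  show ?thesis
  proof (rule is_coboundary_cong [OF is_coboundary_zero])
    fix gs assume "set gs \<subseteq> carrier W" "length gs = 2"
    then have "gs ! 0 \<in> carrier W" by (auto simp: subset_iff)
    then show "X c (gs ! 0) * X (- c) (gs ! 1) = 0" by (simp add: True X_one)
  qed
next
  case False
  \<comment> \<open>Since \<open>X (inverse c) = X c\<close> on the W-group, the two Steinberg
    products add to \<open>X c\<close> times \<open>X d + X e\<close>, and that sum is
    \<open>X (- c)\<close>.\<close>
  define d e where "d = 1 - c" and "e = 1 - inverse c"
  have nz: "d \<noteq> 0" "e \<noteq> 0" using False assms by (auto simp: d_def e_def)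
  have "(- c) * e = d" using assms by (simp add: d_def e_def right_diff_distrib)
  then have Xd: "X d C = X (- c) C + X e C" if "C \<in> carrier W" for C
    using X_mult [OF that, of "- c" e] assms nz by simp
  have "is_coboundary W 2 (\<lambda>gs. X c (gs ! 0) * X d (gs ! 1) +
          X (inverse c) (gs ! 0) * X e (gs ! 1))"
    using assms nz by (intro is_coboundary_add X_Steinberg) (auto simp: d_def e_def)
  then show ?thesis
  proof (rule is_coboundary_cong)
    fix gs assume "set gs \<subseteq> carrier W" "length gs = 2"
    then have "gs ! 0 \<in> carrier W" "gs ! 1 \<in> carrier W" by (auto simp: subset_iff)
    then show "X c (gs ! 0) * X (- c) (gs ! 1) = X c (gs ! 0) * X d (gs ! 1) +
          X (inverse c) (gs ! 0) * X e (gs ! 1)"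
      by (simp only: Xd X_inverse [OF _ assms] distrib_left add.assoc bit_add_self add_0_right)
  qed
qed

text \<open>Milnor's relation: with \<open>s = a + b\<close>, the Steinberg relation for \<open>a/s + b/s = 1\<close> expresses
  the product of the classes of \<open>a\<close> and \<open>b\<close> by products involving the class of \<open>s\<close>.\<close>
lemma X_Milnor:
  assumes "as \<noteq> []" "0 \<notin> set as" "sum_list as = 1"
  shows "is_coboundary W (length as) (cup_list (map X as))"
  using assms
proof (induction "length as" arbitrary: as)
  case 0
  then show ?case by simp
next
  case (Suc n)
  show ?case
  proof (cases as)
    case Nil
    with Suc show ?thesis by simp
  next
    case (Cons a as')
    show ?thesis
    proof (cases as')
      case Nil
      with Cons Suc have as: "as = [1]" by simp
      have "is_coboundary W 1 (cup_list (map X [1]))"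
        by (rule is_coboundary_cong [OF is_coboundary_zero])
           (auto simp: cup1_def length_Suc_conv X_one)
      then show ?thesis by (simp add: as)
    next
      case (Cons b \<xi>)
      have as: "as = a # b # \<xi>" using \<open>as = a # as'\<close> Cons by simp
      have ab: "a \<noteq> 0" "b \<noteq> 0" and \<xi>: "0 \<notin> set \<xi>" using Suc(4) as by auto
      have add\<xi>: "\<forall>x\<in>set (map X \<xi>). additive W x" using \<xi> by (auto intro: additive_X)
      let ?c = "cup_list (map X \<xi>)"
      have goal: "is_coboundary W (2 + length \<xi>) (cup_list (map X as)) \<Longrightarrow> ?thesis"
        by (simp add: as)
      have mult: "is_coboundary W (2 + length \<xi>) (\<lambda>gs. c (gs ! 0) (gs ! 1) * ?c (drop 2 gs))"
        if "is_coboundary W 2 (\<lambda>gs. c (gs ! 0) (gs ! 1))" for c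
        using is_coboundary_mult_cup_list [OF that add\<xi>] by simp
      show ?thesis
      proof (cases "a + b = 0")
        case True
        \<comment> \<open>There is no class of \<open>a + b = 0\<close> to work with, so
          \<open>X_minus\<close> kills the first two factors directly.\<close>
        then have b: "b = - a" by (simp add: add_eq_0_iff)
        show ?thesis
        proof (rule goal, rule is_coboundary_cong [OF mult [OF X_minus [OF ab(1)]]])
          fix gs :: "('b \<Rightarrow> 'b) set list" assume "length gs = 2 + length \<xi>"
          then show "cup_list (map X as) gs = X a (gs ! 0) * X (- a) (gs ! 1) * ?c (drop 2 gs)"
            by (auto simp: as b cup1_def length_Suc_conv mult.assoc)
        qed
      next
        case False
        define s where "s = a + b"
        have s: "s \<noteq> 0" using False by (simp add: s_def)
        have "n = length (s # \<xi>)" "0 \<notin> set (s # \<xi>)" "sum_list (s # \<xi>) = 1"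
          using Suc(2,5) as s \<xi> by (auto simp: s_def add.assoc)
        then have "is_coboundary W (length (s # \<xi>)) (cup_list (map X (s # \<xi>)))"
          using Suc(1) by blast
        then have ih: "is_coboundary W (Suc (length \<xi>)) (cup_list (map X (s # \<xi>)))" by simp
        have "a * inverse s + b * inverse s = 1"
          using s by (simp add: s_def flip: distrib_right)
        then have st: "is_coboundary W 2
            (\<lambda>gs. X (a * inverse s) (gs ! 0) * X (b * inverse s) (gs ! 1))"
          using ab s by (intro X_Steinberg) auto
        have cup: "is_coboundary W (2 + length \<xi>) (cup1 (X c) (cup_list (map X (s # \<xi>))))"
          if "c \<noteq> 0" for c
          using is_coboundary_cup1 [OF additive_X [OF that] ih] by simp
        \<comment> \<open>The Steinberg product expands into the wanted product and terms with
          \<open>X s\<close>. Commutativity moves \<open>X s\<close> next to the classes of \<xi>,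
          where the induction hypothesis for \<open>s # \<xi>\<close> applies; it accounts for the
          last three summands.\<close>
        have total: "is_coboundary W (2 + length \<xi>) (\<lambda>gs.
            X (a * inverse s) (gs ! 0) * X (b * inverse s) (gs ! 1) * ?c (drop 2 gs) +
            (X s (gs ! 0) * X b (gs ! 1) + X b (gs ! 0) * X s (gs ! 1)) * ?c (drop 2 gs) +
            cup1 (X a) (cup_list (map X (s # \<xi>))) gs +
            cup1 (X b) (cup_list (map X (s # \<xi>))) gs +
            cup1 (X s) (cup_list (map X (s # \<xi>))) gs)"
          using ab s
          by (intro is_coboundary_add cup
              mult [OF st] mult [OF is_coboundary_cup_commute] additive_X)
        show ?thesis
        proof (rule goal, rule is_coboundary_cong [OF total])
          fix gs assume gs: "set gs \<subseteq> carrier W" "length gs = 2 + length \<xi>"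
          then obtain g1 g2 r where r: "gs = g1 # g2 # r" by (auto simp: length_Suc_conv)
          have eq: "u * v * c = (u + w) * (v + w) * c + (w * v + v * w) * c + u * (w * c) +
              v * (w * c) + w * (w * c)" for u v w c :: bit
            by (simp add: algebra_simps)
          have "g1 \<in> carrier W" "g2 \<in> carrier W" using gs r by auto
          then have "X (a * inverse s) g1 = X a g1 + X s g1" "X (b * inverse s) g2 = X b g2 + X s g2"
            using ab s by (simp_all add: X_mult X_inverse)
          then show "cup_list (map X as) gs =
            X (a * inverse s) (gs ! 0) * X (b * inverse s) (gs ! 1) * ?c (drop 2 gs) +
            (X s (gs ! 0) * X b (gs ! 1) + X b (gs ! 0) * X s (gs ! 1)) * ?c (drop 2 gs) +
            cup1 (X a) (cup_list (map X (s # \<xi>))) gs +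
            cup1 (X b) (cup_list (map X (s # \<xi>))) gs +
            cup1 (X s) (cup_list (map X (s # \<xi>))) gs"
            by (simp add: r as cup1_def algebra_simps)
        qed
      qed
    qed
  qed
qed

section \<open>Nilpotence from a representation of -1 as a sum of squares\<close>

lemma nilpotent_if_not_formally_real:
  assumes "\<not> formally_real TYPE('a)"
  shows "nilpotent_class W (X (- 1))"
proof -
  obtain xs :: "'a list" where xs: "sum_list (map (\<lambda>x. x * x) xs) = - 1"
    using assms unfolding formally_real_def by blast
  \<comment> \<open>Milnor's relation asks for nonzero entries, so zero summands are discarded. The
    list stays nonempty because the negated squares sum to 1.\<close>
  define ys where "ys = filter (\<lambda>x. x \<noteq> 0) xs"
  have "sum_list (map (\<lambda>x. x * x) ys) = - 1"
    using xs unfolding ys_def by (subst sum_list_map_filter) auto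
  moreover have "sum_list (map (\<lambda>x. (- 1) * (x * x)) zs) = - sum_list (map (\<lambda>x. x * x) zs)"
    for zs :: "'a list" by (induction zs) auto
  ultimately have sum: "sum_list (map (\<lambda>x. (- 1) * (x * x)) ys) = 1" by simp
  then have ne: "ys \<noteq> []" by auto
  have nz: "x \<noteq> 0" if "x \<in> set ys" for x using that by (auto simp: ys_def)
  have "is_coboundary W (length ys) (cup_list (map X (map (\<lambda>x. (- 1) * (x * x)) ys)))"
    using X_Milnor [of "map (\<lambda>x. (- 1) * (x * x)) ys"] sum ne nz by (auto simp: image_iff)
  \<comment> \<open>Each entry is \<open>- 1\<close> times a nonzero square, so every factor of the
    product is the class of \<open>- 1\<close>.\<close>
  moreover have "cup_power (X (- 1)) gs = cup_list (map X (map (\<lambda>x. (- 1) * (x * x)) zs)) gs"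
    if "set gs \<subseteq> carrier W" "length gs = length zs" "0 \<notin> set zs" for gs zs
    using that
  proof (induction zs arbitrary: gs)
    case (Cons z zs)
    then obtain g r where "gs = g # r" by (auto simp: length_Suc_conv)
    with Cons X_mult_square [of g "- 1" z] show ?case
      by (simp add: cup_power_def cup1_def)
  qed (simp add: cup_power_def)
  ultimately have "is_coboundary W (length ys) (cup_power (X (- 1)))"
    using nz by (elim is_coboundary_cong) blast
  moreover have "length ys \<ge> 1" using ne by (cases ys) auto
  ultimately show ?thesis unfolding nilpotent_class_def by blast
qed

section \<open>Complex conjugation in the formally real case\<close>

lemma subfield_set_range: "subfield_set (range i)"
  unfolding subfield_set_def
  by (safe, metis i_one rangeI, metis i_add rangeI, metis i_mult rangeI, metis i_minus rangeI,
      metis i_inverse rangeI)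

lemma formally_real_range:
  assumes "formally_real TYPE('a)"
  shows "- 1 \<notin> sum_squares (range i)"
proof
  have *: "\<exists>xs. c = i (sum_list (map (\<lambda>x. x * x) xs))" if "c \<in> sum_squares (range i)" for c
    using that
  proof induction
    case zero
    show ?case by (rule exI [of _ "[]"]) (simp add: i_zero)
  next
    case (step c y)
    then obtain xs x where "c = i (sum_list (map (\<lambda>x. x * x) xs))" "y = i x" by auto
    then have "c + y * y = i (sum_list (map (\<lambda>x. x * x) (x # xs)))"
      by (simp add: i_add i_mult add.commute)
    then show ?case by blast
  qed
  assume "- 1 \<in> sum_squares (range i)"
  then obtain xs where "- 1 = i (sum_list (map (\<lambda>x. x * x) xs))" using * by blast
  then have "i (sum_list (map (\<lambda>x. x * x) xs) + 1) = 0"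
    by (metis i_add i_one add.left_inverse)
  then have "sum_list (map (\<lambda>x. x * x) xs) = - 1"
    by (simp only: i_eq_0_iff add_eq_0_iff2)
  with assms show False unfolding formally_real_def by blast
qed

text \<open>The field \<open>adjoin R j\<close> contains the image of \<open>i\<close> and is closed
  under square roots, so minimality of the quadratic closure makes it everything. Conjugation over
  \<open>R\<close> is then the required involution; it fixes the image of \<open>i\<close> and
  negates \<open>j\<close>.\<close>

lemma ex_complex_conjugation:
  assumes "formally_real TYPE('a)"
  obtains \<sigma> where "\<sigma> \<in> carrier G" "\<sigma> \<circ> \<sigma> = id" "chi (- 1) \<sigma> = 1"
proof -
  obtain R where RR: "range i \<subseteq> R" "subfield_set R" "- 1 \<notin> sum_squares R"
    and max: "\<And>T. subfield_set T \<Longrightarrow> - 1 \<notin> sum_squares T \<Longrightarrow> R \<subseteq> T \<Longrightarrow> T = R"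
    using ex_maximal_formally_real_subfield [OF subfield_set_range formally_real_range [OF assms]]
    by metis
  interpret maximal_real_subfield R
    using RR max two' ex_sqrt by unfold_locales auto
  obtain j :: 'b where j: "j * j = - 1" using ex_sqrt by blast
  have jR: "j \<notin> R" by (rule imaginary_unit_notin [OF j])
  have minus1: "- 1 \<in> R" using RR(2) by (simp add: subfield_setD)
  have "adjoin R j = UNIV"
  proof (rule UNIV_if_sqrt_closed)
    show "subfield_set (adjoin R j)" using subfield_set_adjoin [OF RR(2), of j] j minus1 by simp
    show "i a \<in> adjoin R j" for a using RR(1) by (intro adjoin_base [OF RR(2)]) auto
    show "y \<in> adjoin R j" if "x \<in> adjoin R j" "y * y = x" for x y
      using sqrt_in_adjoin_imaginary_unit [OF j] that by blast
  qed
  then have dec: "\<exists>x y. x \<in> R \<and> y \<in> R \<and> z = x + y * j" for z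
    unfolding adjoin_def by blast
  then obtain f g where fg: "\<And>z. f z \<in> R" "\<And>z. g z \<in> R" "\<And>z. z = f z + g z * j" by metis
  define \<sigma> where "\<sigma> z = f z - g z * j" for z
  \<comment> \<open>Uniqueness of coordinates lets \<sigma> be computed from any decomposition, not
    only the chosen \<open>f\<close> and \<open>g\<close>.\<close>
  have \<sigma>: "\<sigma> (x + y * j) = x - y * j" if "x \<in> R" "y \<in> R" for x y
    using adjoin_unique [OF RR(2) jR fg(1,2) that fg(3) [of "x + y * j", symmetric]]
    by (simp only: \<sigma>_def)
  have \<sigma>_R: "\<sigma> x = x" if "x \<in> R" for x
    using \<sigma> [OF that subfield_setD(2) [OF RR(2)]] by simp
  have "\<sigma> (\<sigma> z) = z" for z
  proof -
    have "\<sigma> z = f z + (- g z) * j" by (simp add: \<sigma>_def)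
    also have "\<sigma> \<dots> = f z - (- g z) * j" using fg RR(2) by (intro \<sigma>) (auto simp: subfield_setD)
    also have "\<dots> = f z + g z * j" by simp
    finally show ?thesis using fg(3) [of z] by simp
  qed
  then have inv: "\<sigma> \<circ> \<sigma> = id" by auto
  have \<sigma>_add: "\<sigma> (z + w) = \<sigma> z + \<sigma> w" for z w
  proof -
    have "z + w = (f z + f w) + (g z + g w) * j"
      using fg(3) [of z] fg(3) [of w] by algebra
    then have "\<sigma> (z + w) = (f z + f w) - (g z + g w) * j"
      using fg(1,2) RR(2) by (metis \<sigma> subfield_setD(3))
    then show ?thesis by (simp add: \<sigma>_def algebra_simps)
  qed
  have \<sigma>_mult: "\<sigma> (z * w) = \<sigma> z * \<sigma> w" for z w
  proof -
    have "z * w = (f z * f w - g z * g w) + (f z * g w + g z * f w) * j"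
      using fg(3) [of z] fg(3) [of w] j by algebra
    then have "\<sigma> (z * w) = (f z * f w - g z * g w) - (f z * g w + g z * f w) * j"
      using fg(1,2) RR(2) by (metis \<sigma> subfield_setD(3,4,7))
    also have "\<dots> = (f z - g z * j) * (f w - g w * j)" using j by algebra
    finally show ?thesis by (simp only: \<sigma>_def)
  qed
  have "\<sigma> (i a) = i a" for a
    using RR(1) by (intro \<sigma>_R) auto
  then have mem: "\<sigma> \<in> carrier G"
    using \<sigma>_add \<sigma>_mult o_bij [OF inv inv]
    by (auto simp: galois_group_def gal_aut_def)
  have "\<sigma> j = sg 1 * j"
    using \<sigma> [OF subfield_setD(2,1) [OF RR(2)]] by (simp add: sg_def)
  moreover have "j * j = i (- 1)" by (simp add: i_minus i_one j)
  ultimately have "chi (- 1) \<sigma> = 1"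
    by (intro chi_eqI [OF mem]) auto
  with mem inv that show ?thesis by blast
qed

text \<open>The cosets of \<open>id\<close> and of complex conjugation multiply like a group of
  order two, and the class of \<open>- 1\<close> separates them.\<close>

lemma not_nilpotent_if_formally_real:
  assumes "formally_real TYPE('a)"
  shows "\<not> nilpotent_class W (X (- 1))"
proof -
  obtain \<sigma> where s: "\<sigma> \<in> carrier G" "\<sigma> \<circ> \<sigma> = id" "chi (- 1) \<sigma> = 1"
    by (rule ex_complex_conjugation [OF assms])
  interpret group G by (rule group_G)
  interpret normal N G by (rule normal_generate_W_gens)
  have "id \<in> carrier G" using one_closed by simp
  note * = rcos_sum [OF this this] rcos_sum [OF this s(1)] rcos_sum [OF s(1) this]
    rcos_sum [OF s(1) s(1)]
  show ?thesis
  proof (rule not_nilpotent_class_if_order_two)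
    show "N #>\<^bsub>G\<^esub> id \<in> carrier W" "N #>\<^bsub>G\<^esub> \<sigma> \<in> carrier W"
      using s \<open>id \<in> carrier G\<close> by (auto simp: carrier_FactGroup)
    show "X (- 1) (N #>\<^bsub>G\<^esub> \<sigma>) = 1" using s by (simp add: X_coset)
    show "X (- 1) (N #>\<^bsub>G\<^esub> id) = 0"
      using additive_one [OF additive_chi [of "- 1"]] \<open>id \<in> carrier G\<close> by (simp add: X_coset)
  qed (use * s(2) in simp_all)
qed

end

theorem theorem3p18:
  fixes i :: "'a::field \<Rightarrow> 'b::field"
  assumes "(2::'a) \<noteq> 0"
    and "finite (square_classes TYPE('a))"
    and "is_quadratic_closure i"
  shows "formally_real TYPE('a) \<longleftrightarrow> \<not> nilpotent_class (W_group i) (x_class i (-1))"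
proof -
  interpret quadratic_closure i
    using assms(1,3) by unfold_locales
  show ?thesis
    using not_nilpotent_if_formally_real nilpotent_if_not_formally_real
    by (auto simp: W_group_eq x_class_eq)
qed

end
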